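(* The unital associative algebra over the polynomial ring $\mathbf{Z}[a,b,c]$ defined by generators $s_1,s_2$ and relations $s_1s_2s_1=s_2s_1s_2$ and $s_i^3=a s_i^2+b s_i+c$ for $i\in\{1,2\}$ is not finitely generated as a $\mathbf{Z}[a,b,c]$-module. Moreover, in the specialization $a=b=0$, i.e. in the $\mathbf{Z}[c]$-algebra with generators $s_1,s_2$ and relations $s_1s_2s_1=s_2s_1s_2$, $s_1^3=s_2^3=c$, the element $(s_1^2s_2^2)^6-c^8$ is a non-zero torsion element of the corresponding $\mathbf{Z}[c]$-module.
   Context: An element $m$ of a module over a domain is torsion if it is annihilated by some nonzero element of the domain. *)

theory Defs
  imports
    "HOL-Library.Poly_Mapping"
    "HOL-Computational_Algebra.Polynomial"
    "HOL-Algebra.Module"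
    "HOL-Algebra.QuotRing"
    "HOL-Algebra.Algebraic_Closure_Type"
begin

section \<open>Free associative algebras\<close>

text \<open>
  The free unital associative \<open>R\<close>-algebra on a set of generators is the monoid algebra of the
  free monoid (words under concatenation). The multiplication of type \<open>poly_mapping\<close> is
  the convolution product with respect to the addition of the index type, so the free monoid has
  to be written additively.
\<close>

datatype 'g free_monoid = Free_Monoid "'g list"

instantiation free_monoid :: (type) monoid_add
begin

definition zero_free_monoid :: "'a free_monoid" where
  "0 = Free_Monoid []"

fun plus_free_monoid :: "'a free_monoid \<Rightarrow> 'a free_monoid \<Rightarrow> 'a free_monoid" where
  "Free_Monoid u + Free_Monoid v = Free_Monoid (u @ v)"

instance
proof
  fix x y z :: "'a free_monoid"
  show "x + y + z = x + (y + z)" by (cases x; cases y; cases z) simp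
  show "0 + x = x" by (cases x) (simp add: zero_free_monoid_def)
  show "x + 0 = x" by (cases x) (simp add: zero_free_monoid_def)
qed

end

type_synonym ('g, 'r) free_algebra = "'g free_monoid \<Rightarrow>\<^sub>0 'r"

definition free_gen :: "'g \<Rightarrow> ('g, 'r::comm_ring_1) free_algebra" where
  "free_gen g = Poly_Mapping.single (Free_Monoid [g]) 1"

definition free_scale :: "'r::comm_ring_1 \<Rightarrow> ('g, 'r) free_algebra \<Rightarrow> ('g, 'r) free_algebra" where
  "free_scale r x = Poly_Mapping.map (\<lambda>t. r * t) x"


section \<open>Algebras given by generators and relations\<close>

text \<open>
  The quotient of the free algebra by the two-sided ideal generated by \<open>rels\<close> (HOL-Algebra ideals
  are two-sided). It is a \<open>module\<close> record so that it carries both its (noncommutative) ring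
  operations and the scalar multiplication; the latter is defined on cosets in the same way as
  \<^const>\<open>rcoset_mult\<close>.
\<close>

definition presented_ideal ::
    "('g, 'r::comm_ring_1) free_algebra set \<Rightarrow> ('g, 'r) free_algebra set" where
  "presented_ideal rels = genideal ring_of_type_algebra rels"

definition presented_algebra ::
    "('g, 'r::comm_ring_1) free_algebra set \<Rightarrow> ('r, ('g, 'r) free_algebra set) module" where
  "presented_algebra rels =
     ring.extend (ring_of_type_algebra Quot presented_ideal rels)
       (module.fields (\<lambda>r C. \<Union>x\<in>C. presented_ideal rels +>\<^bsub>ring_of_type_algebra\<^esub> free_scale r x))"

definition presented_gen ::
    "('g, 'r::comm_ring_1) free_algebra set \<Rightarrow> 'g \<Rightarrow> ('g, 'r) free_algebra set" where
  "presented_gen rels g = presented_ideal rels +>\<^bsub>ring_of_type_algebra\<^esub> free_gen g"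

lemma presented_algebra_simps:
  "carrier (presented_algebra rels) = carrier (ring_of_type_algebra Quot presented_ideal rels)"
  "monoid.mult (presented_algebra rels) = monoid.mult (ring_of_type_algebra Quot presented_ideal rels)"
  "monoid.one (presented_algebra rels) = monoid.one (ring_of_type_algebra Quot presented_ideal rels)"
  "ring.zero (presented_algebra rels) = ring.zero (ring_of_type_algebra Quot presented_ideal rels)"
  "ring.add (presented_algebra rels) = ring.add (ring_of_type_algebra Quot presented_ideal rels)"
  "module.smult (presented_algebra rels) r C =
     (\<Union>x\<in>C. presented_ideal rels +>\<^bsub>ring_of_type_algebra\<^esub> free_scale r x)"
  by (simp_all add: presented_algebra_def ring.extend_def module.fields_def)

text \<open>The construction yields a ring that is a module over the base ring.\<close>

lemma ring_of_type_algebra_simps: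
  "carrier ring_of_type_algebra = UNIV"
  "monoid.mult ring_of_type_algebra x y = x * y"
  "ring.add ring_of_type_algebra x y = x + y"
  "ring.zero ring_of_type_algebra = 0"
  "monoid.one ring_of_type_algebra = 1"
  by (auto simp: ring_of_type_algebra_def)

lemma ring_ring_of_type_algebra: "ring (ring_of_type_algebra :: 'a::ring_1 ring)"
proof -
  have "\<exists>y. x + y = 0" for x :: 'a
    using add.right_inverse by blast
  thus ?thesis
    unfolding ring_of_type_algebra_def using add.right_inverse
    by unfold_locales (auto simp: algebra_simps Units_def)
qed

lemma ideal_presented_ideal: "ideal (presented_ideal rels) ring_of_type_algebra"
  unfolding presented_ideal_def
  by (rule ring.genideal_ideal[OF ring_ring_of_type_algebra])
    (simp add: ring_of_type_algebra_simps)

lemma free_scale_eq: "free_scale r x = Poly_Mapping.single 0 r * x"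
  unfolding free_scale_def by (rule mult_map_scale_conv_mult)

lemma presented_algebra_smult_coset:
  fixes rels :: "('g, 'r::comm_ring_1) free_algebra set"
  shows "r \<odot>\<^bsub>presented_algebra rels\<^esub> (presented_ideal rels +>\<^bsub>ring_of_type_algebra\<^esub> x) =
    presented_ideal rels +>\<^bsub>ring_of_type_algebra\<^esub> free_scale r x"
proof -
  let ?J = "presented_ideal rels"
  let ?F = "ring_of_type_algebra :: ('g, 'r) free_algebra ring"
  interpret ideal ?J ?F by (rule ideal_presented_ideal)
  have eq: "?J +>\<^bsub>?F\<^esub> free_scale r y = ?J +>\<^bsub>?F\<^esub> free_scale r x" if "y \<in> ?J +>\<^bsub>?F\<^esub> x" for y
  proof -
    have "\<exists>j\<in>?J. y = j + x"
      using that unfolding a_r_coset_def' by (simp add: ring_of_type_algebra_simps)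
    then obtain j where j: "j \<in> ?J" "y = j + x" by blast
    have "Poly_Mapping.single 0 r * j \<in> ?J"
      using I_l_closed[of j "Poly_Mapping.single 0 r"] j by (simp add: ring_of_type_algebra_simps)
    then have "free_scale r y \<in> ?J +>\<^bsub>?F\<^esub> free_scale r x"
      using j unfolding a_r_coset_def'
      by (auto simp: free_scale_eq distrib_left ring_of_type_algebra_simps)
    then show ?thesis
      by (intro a_repr_independence[symmetric] a_subgroup) (simp_all add: ring_of_type_algebra_simps)
  qed
  have "x \<in> ?J +>\<^bsub>?F\<^esub> x"
    by (rule a_rcos_self) (simp add: ring_of_type_algebra_simps)
  then have "(\<Union>y\<in>?J +>\<^bsub>?F\<^esub> x. ?J +>\<^bsub>?F\<^esub> free_scale r y) = ?J +>\<^bsub>?F\<^esub> free_scale r x"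
    using eq by blast
  then show ?thesis by (simp only: presented_algebra_simps)
qed

lemma presented_algebra_ring: "ring (presented_algebra rels)"
proof -
  interpret Q: ring "ring_of_type_algebra Quot presented_ideal rels"
    using ideal_presented_ideal by (rule ideal.quotient_is_ring)
  show ?thesis
    by (intro ringI abelian_groupI monoidI, unfold presented_algebra_simps)
      (use Q.a_assoc Q.a_comm Q.m_assoc Q.l_distr Q.r_distr Q.l_neg in \<open>auto intro: Q.a_inv_closed\<close>)
qed

lemma presented_algebra_module:
  fixes rels :: "('g, 'r::comm_ring_1) free_algebra set"
  shows "module ring_of_type_algebra (presented_algebra rels)"
proof -
  let ?A = "presented_algebra rels"
  let ?J = "presented_ideal rels"
  let ?F = "ring_of_type_algebra :: ('g, 'r) free_algebra ring"
  let ?R = "ring_of_type_algebra :: 'r ring"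
  interpret I: ideal ?J ?F by (rule ideal_presented_ideal)
  have carr: "\<exists>x. C = ?J +>\<^bsub>?F\<^esub> x" if "C \<in> carrier ?A" for C
    using that by (auto simp: presented_algebra_simps FactRing_def A_RCOSETS_def')
  have closed: "?J +>\<^bsub>?F\<^esub> x \<in> carrier ?A" for x
    by (auto simp: presented_algebra_simps FactRing_def A_RCOSETS_def' ring_of_type_algebra_simps)
  have add: "(?J +>\<^bsub>?F\<^esub> x) \<oplus>\<^bsub>?A\<^esub> (?J +>\<^bsub>?F\<^esub> y) = ?J +>\<^bsub>?F\<^esub> (x + y)" for x y
    using I.a_rcos_sum[of x y]
    by (simp add: presented_algebra_simps FactRing_def ring_of_type_algebra_simps)
  note smult = presented_algebra_smult_coset[where rels = rels]
  show ?thesis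
  proof (rule moduleI)
    show "cring ?R" by (rule cring_from_type_algebra)
    show "abelian_group ?A" by (rule ring.is_abelian_group[OF presented_algebra_ring])
  next
    fix r C assume "C \<in> carrier ?A"
    then obtain x where "C = ?J +>\<^bsub>?F\<^esub> x" using carr by blast
    then show "r \<odot>\<^bsub>?A\<^esub> C \<in> carrier ?A" by (simp only: smult closed)
  next
    fix r s C assume "C \<in> carrier ?A"
    then obtain x where C: "C = ?J +>\<^bsub>?F\<^esub> x" using carr by blast
    show "(r \<oplus>\<^bsub>?R\<^esub> s) \<odot>\<^bsub>?A\<^esub> C = r \<odot>\<^bsub>?A\<^esub> C \<oplus>\<^bsub>?A\<^esub> s \<odot>\<^bsub>?A\<^esub> C"
      by (simp only: C smult add ring_of_type_algebra_simps free_scale_eq single_add distrib_right)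
    show "(r \<otimes>\<^bsub>?R\<^esub> s) \<odot>\<^bsub>?A\<^esub> C = r \<odot>\<^bsub>?A\<^esub> (s \<odot>\<^bsub>?A\<^esub> C)"
      by (simp only: C smult ring_of_type_algebra_simps free_scale_eq mult.assoc[symmetric]
          mult_single add_0_left)
  next
    fix r C D assume "C \<in> carrier ?A" "D \<in> carrier ?A"
    then obtain x y where C: "C = ?J +>\<^bsub>?F\<^esub> x" and D: "D = ?J +>\<^bsub>?F\<^esub> y" using carr by blast
    show "r \<odot>\<^bsub>?A\<^esub> (C \<oplus>\<^bsub>?A\<^esub> D) = r \<odot>\<^bsub>?A\<^esub> C \<oplus>\<^bsub>?A\<^esub> r \<odot>\<^bsub>?A\<^esub> D"
      by (simp only: C D smult add free_scale_eq distrib_left)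
  next
    fix C assume "C \<in> carrier ?A"
    then obtain x where C: "C = ?J +>\<^bsub>?F\<^esub> x" using carr by blast
    show "\<one>\<^bsub>?R\<^esub> \<odot>\<^bsub>?A\<^esub> C = C"
      by (simp only: C smult ring_of_type_algebra_simps free_scale_eq single_one mult_1_left)
  qed
qed


section \<open>Finite generation and torsion\<close>

definition finitely_generated_module ::
    "('r, 'p) ring_scheme \<Rightarrow> ('r, 'm, 'q) module_scheme \<Rightarrow> bool" where
  "finitely_generated_module R M \<longleftrightarrow>
     (\<exists>S. finite S \<and> S \<subseteq> carrier M \<and>
        (\<forall>x\<in>carrier M. \<exists>f\<in>S \<rightarrow> carrier R. x = (\<Oplus>\<^bsub>M\<^esub>s\<in>S. f s \<odot>\<^bsub>M\<^esub> s)))"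

definition torsion_element ::
    "('r, 'p) ring_scheme \<Rightarrow> ('r, 'm, 'q) module_scheme \<Rightarrow> 'm \<Rightarrow> bool" where
  "torsion_element R M m \<longleftrightarrow>
     m \<in> carrier M \<and> (\<exists>r\<in>carrier R. r \<noteq> \<zero>\<^bsub>R\<^esub> \<and> r \<odot>\<^bsub>M\<^esub> m = \<zero>\<^bsub>M\<^esub>)"


section \<open>The cubic quotient of the braid monoid algebra on three strands\<close>

datatype braid_gen = S1 | S2

definition cubic_relators :: "'r::comm_ring_1 \<Rightarrow> 'r \<Rightarrow> 'r \<Rightarrow> (braid_gen, 'r) free_algebra set" where
  "cubic_relators a b c =
     insert (free_gen S1 * free_gen S2 * free_gen S1 - free_gen S2 * free_gen S1 * free_gen S2)
       {free_gen i ^ 3 - (free_scale a (free_gen i ^ 2) + free_scale b (free_gen i) + free_scale c 1)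
        | i. i \<in> {S1, S2}}"

definition cubic_algebra ::
    "'r::comm_ring_1 \<Rightarrow> 'r \<Rightarrow> 'r \<Rightarrow> ('r, (braid_gen, 'r) free_algebra set) module" where
  "cubic_algebra a b c = presented_algebra (cubic_relators a b c)"

definition cubic_gen ::
    "'r::comm_ring_1 \<Rightarrow> 'r \<Rightarrow> 'r \<Rightarrow> braid_gen \<Rightarrow> (braid_gen, 'r) free_algebra set" where
  "cubic_gen a b c i = presented_gen (cubic_relators a b c) i"

text \<open>
  \<open>\<int>[a,b,c]\<close> is the iterated polynomial ring \<open>int poly poly poly\<close>; \<open>a\<close> is the outermost
  indeterminate and \<open>c\<close> the innermost one. \<open>\<int>[c]\<close> is \<open>int poly\<close>.
\<close>

definition indet_a :: "int poly poly poly" where "indet_a = [:0, 1:]"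
definition indet_b :: "int poly poly poly" where "indet_b = [:[:0, 1:]:]"
definition indet_c :: "int poly poly poly" where "indet_c = [:[:[:0, 1:]:]:]"

end

theory Submission
  imports Defs
begin

text \<open>
  Both non-vanishing claims come from reducing modulo a proper ideal \<open>m\<close> of the base ring that
  contains \<open>a\<close>, \<open>b\<close> and \<open>c\<close>, that is, from the degenerate algebra with relations
  \<open>s\<^sub>1 s\<^sub>2 s\<^sub>1 = s\<^sub>2 s\<^sub>1 s\<^sub>2\<close> and \<open>s\<^sub>i\<^sup>3 = 0\<close>. The four words in these relations are
  exactly the words \<open>x y z\<close> of length three with \<open>x = z\<close>. A word in which letters at distance two
  always differ has none of them as a factor, so no relation can be applied to it, and such words
  are linearly independent in the degenerate algebra. Formally, the elements of the free algebra
  whose coefficients at all these words lie in \<open>m\<close> form a two-sided ideal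
  (\<open>ideal_skip_distinct_coeff_ideal\<close>), because the set of these words is closed under taking
  factors, and this ideal contains the relators (\<open>cubic_relators_subset\<close>).

  The words \<open>(s\<^sub>1\<^sup>2 s\<^sub>2\<^sup>2)\<^sup>n\<close> are of this kind. A finite generating set involves only finitely many
  words, so some \<open>(s\<^sub>1\<^sup>2 s\<^sub>2\<^sup>2)\<^sup>n\<close> does not occur in it and cannot be a combination of the generators
  modulo \<open>m\<close> (\<open>cubic_algebra_not_finitely_generated\<close>). Likewise \<open>(s\<^sub>1\<^sup>2 s\<^sub>2\<^sup>2)\<^sup>6 - c\<^sup>8\<close> has coefficient 1
  at \<open>(s\<^sub>1\<^sup>2 s\<^sub>2\<^sup>2)\<^sup>6\<close>, hence is not zero.

  Torsion holds because the element vanishes once \<open>c\<close> is inverted. Then \<open>s\<^sub>i\<^sup>2 = c s\<^sub>i\<^sup>-\<^sup>1\<close>, so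
  \<open>s\<^sub>1\<^sup>2 s\<^sub>2\<^sup>2 = c\<^sup>2 (s\<^sub>2 s\<^sub>1)\<^sup>-\<^sup>1\<close>. The full twist \<open>(s\<^sub>2 s\<^sub>1)\<^sup>3\<close> is central, and in the quotient of the
  braid group by \<open>s\<^sub>i\<^sup>3 = 1\<close>, which is the group \<open>SL\<^sub>2(3)\<close>, its square is trivial; keeping track of \<open>c\<close>
  this reads \<open>(s\<^sub>2 s\<^sub>1)\<^sup>6 = c\<^sup>4\<close>, and so \<open>(s\<^sub>1\<^sup>2 s\<^sub>2\<^sup>2)\<^sup>6 = c\<^sup>1\<^sup>2 c\<^sup>-\<^sup>4 = c\<^sup>8\<close>. The computation in
  \<open>braid_equal_cubes_power\<close> avoids inverses, at the price of a factor \<open>c\<^sup>6\<close>.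
\<close>

section \<open>Words whose letters at distance two differ\<close>

fun skip_distinct :: "'g list \<Rightarrow> bool" where
  "skip_distinct (x # y # z # w) \<longleftrightarrow> x \<noteq> z \<and> skip_distinct (y # z # w)"
| "skip_distinct _ \<longleftrightarrow> True"

lemma skip_distinct_appendD: "skip_distinct (u @ v) \<Longrightarrow> skip_distinct u \<and> skip_distinct v"
proof (induction u rule: skip_distinct.induct)
  case (1 x y z w)
  then show ?case by simp
next
  case ("2_2" x)
  then show ?case by (cases v rule: skip_distinct.cases) auto
next
  case ("2_3" x y)
  then show ?case by (cases v rule: skip_distinct.cases) auto
qed simp

definition square_word :: "nat \<Rightarrow> braid_gen free_monoid" where
  "square_word n = Free_Monoid (concat (replicate n [S1, S1, S2, S2]))"

lemma skip_distinct_square_word: "skip_distinct (concat (replicate n [S1, S1, S2, S2]))"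
proof (induction n)
  case (Suc n)
  then show ?case by (cases n) auto
qed simp

lemma inj_square_word: "inj square_word"
proof (rule injI)
  fix m n assume "square_word m = square_word n"
  then have "length (concat (replicate m [S1, S1, S2, S2])) =
    length (concat (replicate n [S1, S1, S2, S2]))"
    by (simp add: square_word_def)
  then show "m = n" by (simp add: length_concat sum_list_replicate)
qed

lemma square_word_power:
  "(free_gen S1 ^ 2 * free_gen S2 ^ 2) ^ n = Poly_Mapping.single (square_word n) (1::'r::comm_ring_1)"
proof (induction n)
  case 0
  then show ?case by (simp add: square_word_def zero_free_monoid_def[symmetric] single_one)
next
  case (Suc n)
  then show ?case
    by (simp add: square_word_def free_gen_def power2_eq_square mult_single)
qed

section \<open>Ideals detecting these words\<close>

lemma ideal_ring_of_type_algebraI: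
  fixes I :: "'a::ring_1 set"
  assumes "0 \<in> I" and add: "\<And>x y. x \<in> I \<Longrightarrow> y \<in> I \<Longrightarrow> x + y \<in> I"
    and left: "\<And>r x. x \<in> I \<Longrightarrow> r * x \<in> I" and right: "\<And>r x. x \<in> I \<Longrightarrow> x * r \<in> I"
  shows "ideal I ring_of_type_algebra"
proof (rule idealI[OF ring_ring_of_type_algebra])
  interpret R: ring "ring_of_type_algebra :: 'a ring" by (rule ring_ring_of_type_algebra)
  have inv: "\<ominus>\<^bsub>ring_of_type_algebra\<^esub> x = - x" for x :: 'a
    by (rule R.minus_equality) (simp_all add: ring_of_type_algebra_simps)
  show "subgroup I (add_monoid (ring_of_type_algebra :: 'a ring))"
  proof (rule R.add.subgroupI)
    fix x assume "x \<in> I"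
    then show "\<ominus>\<^bsub>ring_of_type_algebra\<^esub> x \<in> I"
      using left[of x "- 1"] by (simp add: inv)
  qed (use assms in \<open>auto simp: ring_of_type_algebra_simps\<close>)
qed (use assms in \<open>auto simp: ring_of_type_algebra_simps\<close>)

lemma ideal_ring_of_type_algebraD:
  fixes I :: "'a::ring_1 set"
  assumes "ideal I ring_of_type_algebra"
  shows "0 \<in> I" "\<And>x y. x \<in> I \<Longrightarrow> y \<in> I \<Longrightarrow> x + y \<in> I"
    "\<And>r x. x \<in> I \<Longrightarrow> r * x \<in> I" "\<And>r x. x \<in> I \<Longrightarrow> x * r \<in> I"
  using additive_subgroup.zero_closed[OF ideal.axioms(1)[OF assms]]
    additive_subgroup.a_closed[OF ideal.axioms(1)[OF assms]]
    ideal.I_l_closed[OF assms] ideal.I_r_closed[OF assms]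
  by (simp_all add: ring_of_type_algebra_simps)

definition skip_distinct_coeff_ideal :: "'r set \<Rightarrow> ('g, 'r::comm_ring_1) free_algebra set" where
  "skip_distinct_coeff_ideal m = {p. \<forall>w. skip_distinct w \<longrightarrow> Poly_Mapping.lookup p (Free_Monoid w) \<in> m}"

lemma Sum_any_mem:
  assumes "0 \<in> m" and "\<And>x y. x \<in> m \<Longrightarrow> y \<in> m \<Longrightarrow> x + y \<in> m" and "\<And>a. f a \<in> m"
  shows "Sum_any f \<in> m"
proof -
  have "sum f A \<in> m" for A
    by (induction A rule: infinite_finite_induct) (use assms in auto)
  then show ?thesis by (simp add: Sum_any.expand_set)
qed

text \<open>
  The coefficient of a product at \<open>w\<close> is a sum of products of coefficients at the two factors of a
  decomposition \<open>w = u @ v\<close>, and \<open>u\<close> and \<open>v\<close> inherit from \<open>w\<close> that letters at distance two differ.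
\<close>

lemma ideal_skip_distinct_coeff_ideal:
  fixes m :: "'r::comm_ring_1 set"
  assumes "ideal m ring_of_type_algebra"
  shows "ideal (skip_distinct_coeff_ideal m) ring_of_type_algebra"
proof -
  note zero = ideal_ring_of_type_algebraD(1)[OF assms]
    and add = ideal_ring_of_type_algebraD(2)[OF assms]
    and mult = ideal_ring_of_type_algebraD(3)[OF assms]
    and mult' = ideal_ring_of_type_algebraD(4)[OF assms]
  have prod: "Poly_Mapping.lookup (p * q) (Free_Monoid w) \<in> m"
    if w: "skip_distinct w" and pq: "p \<in> skip_distinct_coeff_ideal m \<or> q \<in> skip_distinct_coeff_ideal m"
    for p q :: "('g, 'r) free_algebra" and w
  proof -
    have factors: "skip_distinct u \<and> skip_distinct v"
      if "Free_Monoid w = Free_Monoid u + Free_Monoid v" for u v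
      using that w by (auto dest: skip_distinct_appendD)
    have "Poly_Mapping.lookup p k *
      Sum_any (\<lambda>l. Poly_Mapping.lookup q l when Free_Monoid w = k + l) \<in> m" for k
    proof (cases "\<exists>l. Free_Monoid w = k + l")
      case False
      then show ?thesis by (simp add: zero)
    next
      case True
      show ?thesis
      proof (cases "p \<in> skip_distinct_coeff_ideal m")
        case p: True
        obtain u v where "k = Free_Monoid u" "Free_Monoid w = k + Free_Monoid v"
          using True by (metis free_monoid.exhaust)
        then have "Poly_Mapping.lookup p k \<in> m"
          using p factors by (auto simp: skip_distinct_coeff_ideal_def)
        then show ?thesis by (rule mult')
      next
        case False
        then have q: "q \<in> skip_distinct_coeff_ideal m" using pq by simp
        have "(Poly_Mapping.lookup q l when Free_Monoid w = k + l) \<in> m" for l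
        proof (cases k; cases l)
          fix u v assume "k = Free_Monoid u" "l = Free_Monoid v"
          then show ?thesis
            using q factors[of u v] zero by (auto simp: skip_distinct_coeff_ideal_def when_def)
        qed
        then show ?thesis by (intro mult Sum_any_mem) (simp_all add: zero add)
      qed
    qed
    then show ?thesis
      unfolding lookup_mult by (intro Sum_any_mem) (simp_all add: zero add)
  qed
  show ?thesis
    by (rule ideal_ring_of_type_algebraI)
      (auto simp: skip_distinct_coeff_ideal_def lookup_add zero add intro: prod
        [unfolded skip_distinct_coeff_ideal_def mem_Collect_eq])
qed

lemma lookup_free_scale: "Poly_Mapping.lookup (free_scale r p) w = r * Poly_Mapping.lookup p w"
  by (simp add: free_scale_def map.rep_eq when_def)

text \<open>
  The words of the braid relation and the cubes \<open>s\<^sub>i\<^sup>3\<close> repeat a letter at distance two, so they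
  contribute nothing to the relevant coefficients; the other terms have coefficients in the ideal
  generated by \<open>a\<close>, \<open>b\<close> and \<open>c\<close>.
\<close>

lemma cubic_relators_subset:
  assumes m: "ideal m ring_of_type_algebra" and abc: "a \<in> m" "b \<in> m" "c \<in> m"
  shows "cubic_relators a b c \<subseteq> skip_distinct_coeff_ideal m"
proof -
  note zero = ideal_ring_of_type_algebraD(1)[OF m]
    and add = ideal_ring_of_type_algebraD(2)[OF m]
    and mult = ideal_ring_of_type_algebraD(4)[OF m]
  have neg: "- x \<in> m" if "x \<in> m" for x
    using mult[OF that, of "- 1"] by simp
  have "Poly_Mapping.lookup (free_gen S1 * free_gen S2 * free_gen S1 - free_gen S2 * free_gen S1 * free_gen S2
      :: (braid_gen, 'a) free_algebra) (Free_Monoid w) \<in> m" if "skip_distinct w" for w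
    using that
    by (auto simp: free_gen_def mult_single lookup_minus lookup_single when_def zero)
  moreover have "Poly_Mapping.lookup (free_gen i ^ 3 - (free_scale a (free_gen i ^ 2) + free_scale b (free_gen i)
      + free_scale c 1) :: (braid_gen, 'a) free_algebra) (Free_Monoid w) \<in> m"
    if "skip_distinct w" for w i
  proof -
    have "Poly_Mapping.lookup (free_gen i ^ 3 :: (braid_gen, 'a) free_algebra) (Free_Monoid w) = 0"
      using that by (auto simp: free_gen_def power3_eq_cube mult_single lookup_single when_def)
    moreover have "a * x + b * y + c * z \<in> m" for x y z
      using abc by (intro add mult)
    ultimately show ?thesis
      by (simp only: lookup_minus lookup_add lookup_free_scale diff_0 neg)
  qed
  ultimately show ?thesis
    by (auto simp: cubic_relators_def skip_distinct_coeff_ideal_def)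
qed

lemma cubic_ideal_coeff_square_word:
  assumes m: "ideal m ring_of_type_algebra" and abc: "a \<in> m" "b \<in> m" "c \<in> m"
    and p: "p \<in> presented_ideal (cubic_relators a b c)"
  shows "Poly_Mapping.lookup p (square_word n) \<in> m"
proof -
  have "presented_ideal (cubic_relators a b c) \<subseteq> skip_distinct_coeff_ideal m"
    unfolding presented_ideal_def
    by (intro ring.genideal_minimal ring_ring_of_type_algebra ideal_skip_distinct_coeff_ideal
        cubic_relators_subset assms)
  then show ?thesis
    using p skip_distinct_square_word by (auto simp: skip_distinct_coeff_ideal_def square_word_def)
qed

section \<open>The quotient map\<close>

definition presented_class ::
    "('g, 'r::comm_ring_1) free_algebra set \<Rightarrow> ('g, 'r) free_algebra \<Rightarrow> ('g, 'r) free_algebra set" where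
  "presented_class rels x = presented_ideal rels +>\<^bsub>ring_of_type_algebra\<^esub> x"

lemma presented_class_hom:
  "presented_class rels \<in> ring_hom ring_of_type_algebra (presented_algebra rels)"
  using ideal.rcos_ring_hom[OF ideal_presented_ideal[of rels]]
  unfolding ring_hom_def presented_algebra_simps presented_class_def by simp

lemma presented_class_eq_iff:
  "presented_class rels x = presented_class rels y \<longleftrightarrow> x - y \<in> presented_ideal rels"
proof -
  interpret ideal "presented_ideal rels" "ring_of_type_algebra :: ('a, 'b) free_algebra ring"
    by (rule ideal_presented_ideal)
  have inv: "\<ominus>\<^bsub>ring_of_type_algebra\<^esub> x = - x" for x :: "('a, 'b) free_algebra"
    by (rule minus_equality) (simp_all add: ring_of_type_algebra_simps)
  show ?thesis
    unfolding presented_class_def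
    using quotient_eq_iff_same_a_r_cos[OF ideal_presented_ideal, of x y]
    by (simp add: ring_of_type_algebra_simps a_minus_def inv)
qed

lemma presented_class_simps:
  "presented_class rels x \<in> carrier (presented_algebra rels)"
  "presented_class rels 0 = \<zero>\<^bsub>presented_algebra rels\<^esub>"
  "presented_class rels 1 = \<one>\<^bsub>presented_algebra rels\<^esub>"
  "presented_class rels (x + y) =
     presented_class rels x \<oplus>\<^bsub>presented_algebra rels\<^esub> presented_class rels y"
  "presented_class rels (x * y) =
     presented_class rels x \<otimes>\<^bsub>presented_algebra rels\<^esub> presented_class rels y"
  "presented_class rels (x - y) =
     presented_class rels x \<ominus>\<^bsub>presented_algebra rels\<^esub> presented_class rels y"
  "presented_class rels (x ^ n) = presented_class rels x [^]\<^bsub>presented_algebra rels\<^esub> n"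
  "presented_class rels (free_scale r x) = r \<odot>\<^bsub>presented_algebra rels\<^esub> presented_class rels x"
proof -
  interpret A: ring "presented_algebra rels" by (rule presented_algebra_ring)
  interpret h: ring_hom_ring ring_of_type_algebra "presented_algebra rels" "presented_class rels"
    by (intro ring_hom_ringI2 ring_ring_of_type_algebra presented_algebra_ring presented_class_hom)
  show closed: "presented_class rels x \<in> carrier (presented_algebra rels)" for x
    using h.hom_closed by (simp add: ring_of_type_algebra_simps)
  show "presented_class rels 0 = \<zero>\<^bsub>presented_algebra rels\<^esub>"
    using h.hom_zero by (simp add: ring_of_type_algebra_simps)
  show one: "presented_class rels 1 = \<one>\<^bsub>presented_algebra rels\<^esub>"
    using h.hom_one by (simp add: ring_of_type_algebra_simps)
  show add: "presented_class rels (x + y) =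
     presented_class rels x \<oplus>\<^bsub>presented_algebra rels\<^esub> presented_class rels y" for x y
    using h.hom_add[of x y] by (simp add: ring_of_type_algebra_simps)
  show mult: "presented_class rels (x * y) =
     presented_class rels x \<otimes>\<^bsub>presented_algebra rels\<^esub> presented_class rels y" for x y
    using h.hom_mult[of x y] by (simp add: ring_of_type_algebra_simps)
  show "presented_class rels (x - y) =
     presented_class rels x \<ominus>\<^bsub>presented_algebra rels\<^esub> presented_class rels y"
    using add[of "x - y" y] closed
    by (simp add: a_minus_def A.a_assoc A.r_neg)
  show "presented_class rels (x ^ n) = presented_class rels x [^]\<^bsub>presented_algebra rels\<^esub> n"
    by (induction n) (simp_all add: one mult power_Suc2 del: power_Suc)
  show "presented_class rels (free_scale r x) = r \<odot>\<^bsub>presented_algebra rels\<^esub> presented_class rels x"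
    unfolding presented_class_def by (rule presented_algebra_smult_coset[symmetric])
qed

lemma presented_class_surj:
  assumes "C \<in> carrier (presented_algebra rels)"
  obtains x where "C = presented_class rels x"
  using assms
  by (auto simp: presented_algebra_simps FactRing_def A_RCOSETS_def' presented_class_def)

lemma presented_class_sum:
  assumes "finite S"
  shows "presented_class rels (\<Sum>s\<in>S. p s) =
    (\<Oplus>\<^bsub>presented_algebra rels\<^esub>s\<in>S. presented_class rels (p s))"
proof -
  interpret A: ring "presented_algebra rels" by (rule presented_algebra_ring)
  show ?thesis
    using assms by (induction S) (simp_all add: presented_class_simps)
qed

section \<open>Infinite generation\<close>

text \<open>
  Modulo \<open>m\<close> the words \<open>(s\<^sub>1\<^sup>2 s\<^sub>2\<^sup>2)\<^sup>n\<close> are infinitely many independent elements. To contradict a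
  finite generating set, a single coefficient suffices: for a word that occurs in none of the
  chosen representatives \<open>p s\<close> of the generators, it is 1 on one side and 0 on the other, although
  both sides must agree modulo \<open>m\<close>.
\<close>

lemma cubic_algebra_not_finitely_generated:
  fixes a b c :: "'r::comm_ring_1"
  assumes m: "ideal m ring_of_type_algebra" "1 \<notin> m" and abc: "a \<in> m" "b \<in> m" "c \<in> m"
  shows "\<not> finitely_generated_module (ring_of_type_algebra :: 'r ring) (cubic_algebra a b c)"
proof
  let ?cl = "presented_class (cubic_relators a b c)"
  let ?H = "presented_algebra (cubic_relators a b c)"
  assume "finitely_generated_module (ring_of_type_algebra :: 'r ring) (cubic_algebra a b c)"
  then obtain S where S: "finite S" "S \<subseteq> carrier ?H"
    and gen: "\<forall>x\<in>carrier ?H. \<exists>f\<in>S \<rightarrow> carrier ring_of_type_algebra.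
      x = (\<Oplus>\<^bsub>?H\<^esub>s\<in>S. f s \<odot>\<^bsub>?H\<^esub> s)"
    unfolding finitely_generated_module_def cubic_algebra_def by (elim exE conjE)
  have "\<forall>s\<in>S. \<exists>p. s = ?cl p" using S(2) by (blast elim: presented_class_surj)
  then obtain p where p: "\<And>s. s \<in> S \<Longrightarrow> s = ?cl (p s)" by metis
  have "finite (square_word -` (\<Union>s\<in>S. Poly_Mapping.keys (p s)))"
    using S(1) inj_square_word by (intro finite_vimageI) auto
  then obtain n where "n \<notin> square_word -` (\<Union>s\<in>S. Poly_Mapping.keys (p s))"
    using ex_new_if_finite[OF infinite_UNIV_nat] by blast
  then have n: "Poly_Mapping.lookup (p s) (square_word n) = 0" if "s \<in> S" for s
    using that by (auto simp: in_keys_iff)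
  let ?w = "Poly_Mapping.single (square_word n) (1::'r)"
  obtain f where "?cl ?w = (\<Oplus>\<^bsub>?H\<^esub>s\<in>S. f s \<odot>\<^bsub>?H\<^esub> s)"
    using bspec[OF gen presented_class_simps(1)[of _ ?w]] by (elim bexE)
  also have "\<dots> = (\<Oplus>\<^bsub>?H\<^esub>s\<in>S. ?cl (free_scale (f s) (p s)))"
  proof -
    interpret H: ring ?H by (rule presented_algebra_ring)
    have "f s \<odot>\<^bsub>?H\<^esub> s = ?cl (free_scale (f s) (p s))" if "s \<in> S" for s
      using p[OF that] presented_class_simps(8) by metis
    then show ?thesis
      by (intro H.finsum_cong') (simp_all add: Pi_def presented_class_simps(1))
  qed
  also have "\<dots> = ?cl (\<Sum>s\<in>S. free_scale (f s) (p s))"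
    using S(1) by (simp add: presented_class_sum)
  finally have "?w - (\<Sum>s\<in>S. free_scale (f s) (p s)) \<in> presented_ideal (cubic_relators a b c)"
    by (simp only: presented_class_eq_iff)
  then have "Poly_Mapping.lookup (?w - (\<Sum>s\<in>S. free_scale (f s) (p s))) (square_word n) \<in> m"
    by (rule cubic_ideal_coeff_square_word[OF m(1) abc])
  then show False
    using m(2) n by (simp add: lookup_minus lookup_sum lookup_free_scale)
qed

section \<open>Torsion\<close>

text \<open>
  Put \<open>u = t s\<close> and \<open>v = s\<^sup>2 t\<^sup>2\<close>. Then \<open>u v = v u = c\<^sup>2\<close>, and \<open>z = u\<^sup>3\<close> is the full twist, which is
  central. Multiplying \<open>z\<close> by a generator creates a cube, and doing so with both generators gives
  \<open>u\<^sup>7 = z\<^sup>2 u = c\<^sup>4 u\<close>. Multiplication by \<open>v\<^sup>7\<close> turns this into \<open>c\<^sup>1\<^sup>4 = c\<^sup>4 u v\<^sup>7 = c\<^sup>6 v\<^sup>6\<close>. Here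
  \<open>c\<close> commutes with both generators because it is the cube of each of them.
\<close>

lemma (in monoid) braid_equal_cubes_power:
  assumes s: "s \<in> carrier G" and t: "t \<in> carrier G"
    and braid: "s \<otimes> (t \<otimes> s) = t \<otimes> (s \<otimes> t)"
    and scube: "s \<otimes> (s \<otimes> s) = c" and tcube: "t \<otimes> (t \<otimes> t) = c"
  shows "c [^] (6::nat) \<otimes> (s [^] (2::nat) \<otimes> t [^] (2::nat)) [^] (6::nat) = c [^] (14::nat)"
proof -
  have c: "c \<in> carrier G" using s scube by auto
  have cs: "s \<otimes> c = c \<otimes> s" using s by (simp add: scube[symmetric] m_assoc)
  have ct: "t \<otimes> c = c \<otimes> t" using t by (simp add: tcube[symmetric] m_assoc)
  \<comment> \<open>The relations under an arbitrary right factor, as needed to rewrite right-nested products.\<close>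
  have braid': "s \<otimes> (t \<otimes> (s \<otimes> x)) = t \<otimes> (s \<otimes> (t \<otimes> x))" if "x \<in> carrier G" for x
    using s t that braid by (metis m_assoc m_closed)
  have scube': "s \<otimes> (s \<otimes> (s \<otimes> x)) = c \<otimes> x" if "x \<in> carrier G" for x
    using s that by (simp add: scube[symmetric] m_assoc)
  have tcube': "t \<otimes> (t \<otimes> (t \<otimes> x)) = c \<otimes> x" if "x \<in> carrier G" for x
    using t that by (simp add: tcube[symmetric] m_assoc)
  have cs': "s \<otimes> (c \<otimes> x) = c \<otimes> (s \<otimes> x)" if "x \<in> carrier G" for x
    using s c that cs by (metis m_assoc)
  have ct': "t \<otimes> (c \<otimes> x) = c \<otimes> (t \<otimes> x)" if "x \<in> carrier G" for x
    using t c that ct by (metis m_assoc)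
  \<comment> \<open>Up to powers of \<open>c\<close>, \<open>u\<close> and \<open>v\<close> are mutually inverse; \<open>z\<close> is the full twist.\<close>
  define u where "u = t \<otimes> s"
  define v where "v = s [^] (2::nat) \<otimes> t [^] (2::nat)"
  define z where "z = u \<otimes> (u \<otimes> u)"
  note comm = cs ct cs' ct'
  have u: "u \<in> carrier G" and v: "v \<in> carrier G" and z: "z \<in> carrier G"
    using s t by (simp_all add: u_def v_def z_def)
  have v_eq: "v = s \<otimes> (s \<otimes> (t \<otimes> t))"
    using s t by (simp add: v_def numeral_2_eq_2 m_assoc)
  have z1: "z = s \<otimes> (t \<otimes> (s \<otimes> (s \<otimes> (t \<otimes> s))))"
    using s t by (simp add: z_def u_def m_assoc braid'[of "s \<otimes> (t \<otimes> s)", symmetric])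
  have z2: "z = t \<otimes> (s \<otimes> (t \<otimes> (t \<otimes> (s \<otimes> t))))"
    using s t by (simp add: z_def u_def m_assoc braid)
  have z3: "z = s \<otimes> (t \<otimes> (s \<otimes> (t \<otimes> (s \<otimes> t))))"
    using s t by (simp add: z1 braid)
  have tz: "t \<otimes> z = c \<otimes> (s \<otimes> (t \<otimes> (t \<otimes> s)))"
  proof -
    have "t \<otimes> z = s \<otimes> (t \<otimes> (s \<otimes> (s \<otimes> (s \<otimes> (t \<otimes> s)))))"
      using s t by (simp add: z1 braid'[symmetric])
    then show ?thesis using s t c by (simp add: scube' comm)
  qed
  have sz: "s \<otimes> z = c \<otimes> (t \<otimes> (s \<otimes> (s \<otimes> t)))"
  proof -
    have "s \<otimes> z = t \<otimes> (s \<otimes> (t \<otimes> (t \<otimes> (t \<otimes> (s \<otimes> t)))))"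
      using s t by (simp add: z2 braid')
    then show ?thesis using s t c by (simp add: tcube' comm)
  qed
  have zt: "z \<otimes> t = t \<otimes> z"
  proof -
    have "z \<otimes> t = t \<otimes> (s \<otimes> (t \<otimes> (s \<otimes> (t \<otimes> (s \<otimes> t)))))"
      using s t by (simp add: z_def u_def m_assoc)
    then show ?thesis by (simp add: z3)
  qed
  have zs: "z \<otimes> s = s \<otimes> z"
  proof -
    have "z \<otimes> s = s \<otimes> (t \<otimes> (s \<otimes> (t \<otimes> (s \<otimes> (t \<otimes> s)))))"
      using s t by (simp add: z3 m_assoc)
    also have "\<dots> = s \<otimes> z" using s t by (simp add: z_def u_def m_assoc)
    finally show ?thesis .
  qed
  have "u [^] (7::nat) = z \<otimes> (z \<otimes> u)"
    using u by (simp add: z_def numeral_eq_Suc m_assoc)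
  also have "\<dots> = (t \<otimes> z) \<otimes> (s \<otimes> z)"
    using s t z by (metis m_assoc m_closed u_def zs zt)
  also have "\<dots> = c \<otimes> (c \<otimes> (s \<otimes> (t \<otimes> (t \<otimes> (s \<otimes> (t \<otimes> (s \<otimes> (s \<otimes> t))))))))"
    using s t c by (simp add: tz sz m_assoc comm)
  also have "\<dots> = c \<otimes> (c \<otimes> (s \<otimes> (t \<otimes> (t \<otimes> (t \<otimes> (s \<otimes> (t \<otimes> (s \<otimes> t))))))))"
    using s t by (simp add: braid')
  also have "\<dots> = c \<otimes> (c \<otimes> (c \<otimes> (s \<otimes> (s \<otimes> (s \<otimes> (t \<otimes> s))))))"
    using s t c by (simp add: tcube' comm braid)
  also have "\<dots> = c [^] (4::nat) \<otimes> u"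
    using s t c by (simp add: scube' comm numeral_eq_Suc m_assoc u_def)
  finally have u7: "u [^] (7::nat) = c [^] (4::nat) \<otimes> u" .
  have uv: "u \<otimes> v = c [^] (2::nat)" and vu: "v \<otimes> u = c [^] (2::nat)"
    using s t c by (simp_all add: u_def v_eq m_assoc scube' scube tcube' tcube comm numeral_2_eq_2)
  have "c [^] (14::nat) = (u \<otimes> v) [^] (7::nat)"
    using c by (simp add: uv nat_pow_pow)
  also have "\<dots> = u [^] (7::nat) \<otimes> v [^] (7::nat)"
    using u v by (intro pow_mult_distrib) (simp_all add: uv vu)
  also have "\<dots> = c [^] (4::nat) \<otimes> (u \<otimes> (v \<otimes> v [^] (6::nat)))"
    using u v c nat_pow_Suc2[OF v, of 6] by (simp add: u7 m_assoc)
  also have "\<dots> = c [^] (4::nat) \<otimes> ((u \<otimes> v) \<otimes> v [^] (6::nat))"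
    using u v by (simp add: m_assoc)
  also have "\<dots> = (c [^] (4::nat) \<otimes> c [^] (2::nat)) \<otimes> v [^] (6::nat)"
    using c v by (simp add: uv m_assoc)
  also have "\<dots> = c [^] (6::nat) \<otimes> v [^] (6::nat)"
    using c by (simp add: nat_pow_mult)
  finally show ?thesis by (simp add: v_def)
qed

text \<open>
  Scalar multiplication by \<open>c\<close> is multiplication by the class of the constant \<open>c\<close>, which is the cube
  of both generators; so the identity in monoids applies to the multiplicative monoid of the
  quotient.
\<close>

lemma cubic_element_killed_by_c6:
  fixes c :: "'r::comm_ring_1"
  shows "free_scale (c ^ 6) ((free_gen S1 ^ 2 * free_gen S2 ^ 2) ^ 6 - free_scale (c ^ 8) 1)
    \<in> presented_ideal (cubic_relators 0 0 c)"
proof -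
  let ?rels = "cubic_relators 0 0 c"
  let ?H = "presented_algebra ?rels"
  let ?cl = "presented_class ?rels"
  let ?g = "free_gen :: braid_gen \<Rightarrow> (braid_gen, 'r) free_algebra"
  let ?c = "free_scale c 1 :: (braid_gen, 'r) free_algebra"
  interpret H: ring ?H by (rule presented_algebra_ring)
  have rel: "?cl x = ?cl y" if "x - y \<in> ?rels" for x y
    using that ring.genideal_self[OF ring_ring_of_type_algebra, of ?rels]
    by (auto simp: presented_class_eq_iff presented_ideal_def ring_of_type_algebra_simps)
  have "Poly_Mapping.single (0 :: braid_gen free_monoid) c ^ n = Poly_Mapping.single 0 (c ^ n)" for n
    by (induction n) (simp_all add: mult_single)
  then have scale_power: "free_scale (c ^ n) 1 = ?c ^ n" for n
    by (simp add: free_scale_eq)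
  have "?cl (?g S1 * (?g S2 * ?g S1)) = ?cl (?g S2 * (?g S1 * ?g S2))"
    by (rule rel) (simp add: cubic_relators_def mult.assoc)
  moreover have "?cl (?g i * (?g i * ?g i)) = ?cl ?c" for i
  proof (rule rel)
    have "?g i ^ 3 - (free_scale 0 (?g i ^ 2) + free_scale 0 (?g i) + ?c) \<in> ?rels"
      by (cases i) (auto simp: cubic_relators_def)
    then show "?g i * (?g i * ?g i) - ?c \<in> ?rels"
      by (simp add: free_scale_eq power3_eq_cube mult.assoc)
  qed
  ultimately have "?cl (?c ^ 6 * (?g S1 ^ 2 * ?g S2 ^ 2) ^ 6) = ?cl (?c ^ 14)"
    unfolding presented_class_simps by (intro H.braid_equal_cubes_power presented_class_simps)
  then have "?c ^ 6 * (?g S1 ^ 2 * ?g S2 ^ 2) ^ 6 - ?c ^ 14 \<in> presented_ideal ?rels"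
    by (simp only: presented_class_eq_iff)
  moreover have "free_scale (c ^ 6) x = ?c ^ 6 * x" for x :: "(braid_gen, 'r) free_algebra"
    by (simp add: scale_power[symmetric]) (simp add: free_scale_eq)
  ultimately show ?thesis
    by (simp add: scale_power right_diff_distrib power_add[symmetric])
qed

section \<open>The polynomial base rings\<close>

text \<open>
  Applied three times to the zero ideal of \<open>\<int>\<close>, this shows that the elements of \<open>\<int>[a,b,c]\<close> vanishing
  at the origin form an ideal.
\<close>

lemma ideal_eval_zero: "ideal {p :: 'a::comm_ring_1 poly. poly p 0 \<in> I} ring_of_type_algebra"
  if "ideal I ring_of_type_algebra"
  using ideal_ring_of_type_algebraD[OF that] by (intro ideal_ring_of_type_algebraI) auto

theorem proposition3p4:
  shows "\<not> finitely_generated_module (ring_of_type_algebra :: int poly poly poly ring)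
             (cubic_algebra indet_a indet_b indet_c) \<and>
         (let c = [:0, 1:] :: int poly;
              H = cubic_algebra 0 0 c;
              s1 = cubic_gen 0 0 c S1;
              s2 = cubic_gen 0 0 c S2;
              x = ((s1 [^]\<^bsub>H\<^esub> (2::nat) \<otimes>\<^bsub>H\<^esub> s2 [^]\<^bsub>H\<^esub> (2::nat)) [^]\<^bsub>H\<^esub> (6::nat))
                    \<ominus>\<^bsub>H\<^esub> ((c ^ 8) \<odot>\<^bsub>H\<^esub> \<one>\<^bsub>H\<^esub>)
          in x \<noteq> \<zero>\<^bsub>H\<^esub> \<and> torsion_element ring_of_type_algebra H x)"
proof -
  have I0: "ideal {0::int} ring_of_type_algebra"
    by (rule ideal_ring_of_type_algebraI) auto
  note I1 = ideal_eval_zero[OF I0]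
  note I2 = ideal_eval_zero[OF I1]
  note I3 = ideal_eval_zero[OF I2]
  have not_fg: "\<not> finitely_generated_module (ring_of_type_algebra :: int poly poly poly ring)
             (cubic_algebra indet_a indet_b indet_c)"
    by (rule cubic_algebra_not_finitely_generated[OF I3])
      (simp_all add: indet_a_def indet_b_def indet_c_def)
  let ?c = "[:0, 1:] :: int poly"
  let ?rels = "cubic_relators 0 0 ?c"
  let ?H = "presented_algebra ?rels"
  let ?X = "(free_gen S1 ^ 2 * free_gen S2 ^ 2) ^ 6 - free_scale (?c ^ 8) 1
    :: (braid_gen, int poly) free_algebra"
  have X: "(presented_gen ?rels S1 [^]\<^bsub>?H\<^esub> (2::nat) \<otimes>\<^bsub>?H\<^esub> presented_gen ?rels S2 [^]\<^bsub>?H\<^esub> (2::nat))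
      [^]\<^bsub>?H\<^esub> (6::nat) \<ominus>\<^bsub>?H\<^esub> ((?c ^ 8) \<odot>\<^bsub>?H\<^esub> \<one>\<^bsub>?H\<^esub>) = presented_class ?rels ?X"
    unfolding presented_class_simps by (simp only: presented_gen_def presented_class_def)
  have "presented_class ?rels ?X \<noteq> \<zero>\<^bsub>?H\<^esub>"
  proof
    assume "presented_class ?rels ?X = \<zero>\<^bsub>?H\<^esub>"
    then have "?X \<in> presented_ideal ?rels"
      using presented_class_eq_iff[of ?rels ?X 0] by (simp only: presented_class_simps(2) diff_zero simp_thms)
    then have "Poly_Mapping.lookup ?X (square_word 6) \<in> {p. poly p 0 \<in> {0}}"
      by (intro cubic_ideal_coeff_square_word[OF I1]) simp_all
    moreover have "Poly_Mapping.lookup ?X (square_word 6) = 1"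
    proof -
      have "Poly_Mapping.lookup (1 :: (braid_gen, int poly) free_algebra) (square_word 6) = 0"
        by (simp add: lookup_one square_word_def zero_free_monoid_def when_def numeral_eq_Suc)
      then show ?thesis by (simp add: square_word_power lookup_minus lookup_free_scale)
    qed
    ultimately show False by simp
  qed
  moreover have "torsion_element ring_of_type_algebra ?H (presented_class ?rels ?X)"
    unfolding torsion_element_def
  proof (intro conjI bexI[of _ "?c ^ 6"])
    have "presented_class ?rels (free_scale (?c ^ 6) ?X) = presented_class ?rels 0"
      using cubic_element_killed_by_c6[of ?c] by (simp add: presented_class_eq_iff)
    then show "?c ^ 6 \<odot>\<^bsub>?H\<^esub> presented_class ?rels ?X = \<zero>\<^bsub>?H\<^esub>"
      by (simp only: presented_class_simps(2,8))
  qed (simp_all add: presented_class_simps(1) ring_of_type_algebra_simps)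
  ultimately show ?thesis
    using not_fg unfolding Let_def cubic_algebra_def cubic_gen_def X by blast
qed

end
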